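(* Let $d\geq 1$ and $\alpha\geq 2$ be integers, and set $n=2d+1$. For $(z,t)\in\mathbb{R}^{2d}\times\mathbb{R}$ let $$\|(z,t)\|_\alpha=\big(|z|^\alpha+|t|^{\alpha/2}\big)^{1/\alpha}.$$ Then, for all $0\leq\delta<1$ and $R>1$, $$\#\big(\{m\in\mathbb{Z}^{n}: R-\delta\leq\|m\|_\alpha\leq R+\delta\}\big)\lesssim \begin{cases} \max\{R^{\,n-\frac{1}{\alpha-1}},\,R^n\delta\}, & \text{if } \alpha\geq 2(n-1),\\ \max\{R^{\,n-\frac{1}{2n-3}},\,R^n\delta\}, & \text{if } 2<\alpha<2(n-1),\\ \max\{R^{\,n-\frac{n-2}{n}},\,R^n\delta\}, & \text{if } \alpha=2. \end{cases}$$
   Context: $|z|$ is the Euclidean norm of $z\in\mathbb{R}^{2d}$. $\mathbb{Z}^n=\mathbb{Z}^{2d}\times\mathbb{Z}$ is viewed inside $\mathbb{R}^{2d}\times\mathbb{R}$. $\#(\cdot)$ denotes the cardinality of a finite set. $x\lesssim y$ means $x\leq Cy$ for some constant $C>0$; here $C$ may depend on $d$ and $\alpha$ but not on $R$ or $\delta$. *)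

theory Defs
  imports "HOL-Analysis.Analysis"
begin

text \<open>The norm on the first factor is the Euclidean one on \<^typ>\<open>real ^ 'k\<close>. The root and the
  half-integral power are taken of nonnegative reals, where \<open>0 powr a = 0\<close> is the intended value
  because the exponents are positive.\<close>

definition alpha_norm :: "nat \<Rightarrow> (real ^ 'k) \<times> real \<Rightarrow> real" where
  "alpha_norm \<alpha> p =
     (norm (fst p) ^ \<alpha> + \<bar>snd p\<bar> powr (real \<alpha> / 2)) powr (1 / real \<alpha>)"

definition integer_points :: "((real ^ 'k) \<times> real) set" where
  "integer_points = {(z, t). (\<forall>i. z $ i \<in> \<int>) \<and> t \<in> \<int>}"

end

theory Submission
  imports Defs
begin

text \<open>
  The set is sliced along the last coordinate. Put \<open>p = 2 / \<alpha>\<close>, a number in \<open>(0, 1]\<close>, and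
  \<open>\<rho> = R - \<delta>\<close>. For a fixed lattice point \<open>z\<close> the admissible \<open>t\<close> are those with
  \<open>max 0 B powr p \<le> |t| \<le> A powr p\<close>, where \<open>A = (R + \<delta>) ^ \<alpha> - |z| ^ \<alpha>\<close> and
  \<open>B = (R - \<delta>) ^ \<alpha> - |z| ^ \<alpha>\<close>; their number exceeds the total length of these two intervals by at most
  \<open>2\<close> (\<open>card_int_powr_interval\<close>). Here \<open>A - B\<close> is of order at most \<open>R ^ (\<alpha> - 1) * \<delta>\<close> for every \<open>z\<close>.

  If \<open>z\<close> stays at distance at least \<open>1\<close> inside the equator \<open>|z| = \<rho>\<close>, concavity bounds each length by
  \<open>(A - B) * B powr (p - 1)\<close>, and \<open>B\<close> is at least \<open>(\<rho> - |z|) * \<rho> ^ (\<alpha> - 1)\<close>. The resulting sum of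
  \<open>(\<rho> - |z|) powr (p - 1)\<close> over lattice points behaves like the integral of that function, which
  converges at the sphere (\<open>sum_lattice_distance_powr\<close>), and the total is of order \<open>R ^ n * \<delta>\<close>, as
  for the volume. The points \<open>z\<close> near the equator lie in a shell of bounded thickness and number at
  most a constant times \<open>R ^ (n - 2)\<close> (\<open>card_lattice_shell\<close>); for them each length is at most
  \<open>(A - B) powr p\<close> by subadditivity.

  Altogether (\<open>card_lattice_alpha_shell\<close>) the count is at most a constant times
  \<open>R ^ (n - 1) + \<delta> powr p * R powr (n - p) + R ^ n * \<delta>\<close>. By \<open>powr_interpolation\<close> this is at most a
  constant times \<open>max (R powr (n - \<beta>)) (R ^ n * \<delta>)\<close> whenever \<open>\<beta> \<le> 1\<close> and \<open>\<beta> * (\<alpha> - 2) \<le> 2\<close>, and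
  the exponent \<open>\<beta>\<close> of each of the three cases satisfies these two inequalities.
\<close>

section \<open>Differences and sums of powers\<close>

lemma power_diff_le:
  fixes x y :: real
  assumes "0 \<le> y" "y \<le> x"
  shows "x ^ n - y ^ n \<le> real n * (x - y) * x ^ (n - 1)"
proof -
  have "x ^ n - y ^ n = (x - y) * (\<Sum>i<n. y ^ (n - Suc i) * x ^ i)"
    by (rule power_diff_sumr2)
  also have "\<dots> \<le> (x - y) * (\<Sum>i<n. x ^ (n - 1))"
  proof (intro mult_left_mono sum_mono)
    fix i assume "i \<in> {..<n}"
    then have i: "n - 1 = (n - Suc i) + i" by auto
    have "y ^ (n - Suc i) * x ^ i \<le> x ^ (n - Suc i) * x ^ i"
      using assms by (intro mult_right_mono power_mono) auto
    also have "\<dots> = x ^ (n - 1)" by (simp only: i power_add)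
    finally show "y ^ (n - Suc i) * x ^ i \<le> x ^ (n - 1)" .
  qed (use assms in auto)
  finally show ?thesis by (simp add: mult_ac)
qed

lemma power_diff_ge:
  fixes x y :: real
  assumes "0 \<le> y" "y \<le> x" "n \<ge> 1"
  shows "(x - y) * x ^ (n - 1) \<le> x ^ n - y ^ n"
proof -
  have "y * y ^ (n - 1) \<le> y * x ^ (n - 1)"
    using assms by (intro mult_left_mono power_mono) auto
  moreover have "x ^ n = x * x ^ (n - 1)" "y ^ n = y * y ^ (n - 1)"
    using assms(3) by (auto simp flip: power_Suc)
  ultimately show ?thesis by (simp add: algebra_simps)
qed

text \<open>
  The factor \<open>(x / y) powr p\<close> is at most \<open>x / y\<close>, because \<open>x / y \<ge> 1\<close> and \<open>p \<le> 1\<close>. The bound is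
  sharp, up to the factor \<open>p\<close>, when \<open>x - y\<close> is small compared with \<open>y\<close>.
\<close>
lemma powr_diff_le_tangent:
  fixes x y p :: real
  assumes "0 < y" "y \<le> x" "p \<le> 1"
  shows "x powr p - y powr p \<le> (x - y) * y powr (p - 1)"
proof -
  have "(x / y) powr p \<le> (x / y) powr 1"
    using assms by (intro powr_mono) auto
  then have "y powr p * ((x / y) powr p) \<le> y powr p * (x / y)"
    using assms by (intro mult_left_mono) auto
  then show ?thesis
    using assms by (simp add: powr_divide powr_diff field_simps)
qed

text \<open>
  Subadditivity of \<open>x powr p\<close>. Its bound does not depend on \<open>y\<close>, so it replaces the tangent bound
  where \<open>y\<close> is close to \<open>0\<close>.
\<close>
lemma powr_diff_le_diff_powr:
  fixes x y p :: real
  assumes "0 \<le> y" "y \<le> x" "0 < p" "p \<le> 1"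
  shows "x powr p - y powr p \<le> (x - y) powr p"
proof (cases "x = 0")
  case False
  then have x: "x > 0" using assms by auto
  \<comment> \<open>A number in \<open>[0, 1]\<close> is at most its \<open>p\<close>-th power; apply this to \<open>y / x\<close> and \<open>(x - y) / x\<close>, whose sum is \<open>1\<close>.\<close>
  have le: "u / x \<le> u powr p / x powr p" if "0 \<le> u" "u \<le> x" for u
    using powr_mono'[of p 1 "u / x"] that x assms by (simp add: powr_divide)
  have "1 = y / x + (x - y) / x" using x by (simp add: field_simps)
  also have "\<dots> \<le> y powr p / x powr p + (x - y) powr p / x powr p"
    using assms by (intro add_mono le) auto
  finally show ?thesis using x by (simp add: field_simps)
qed (use assms in auto)

text \<open>
  Each summand is at most the increment of \<open>x powr p / p\<close> over the preceding unit interval, because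
  the derivative \<open>x powr (p - 1)\<close> decreases.
\<close>
lemma sum_powr_le:
  fixes p :: real
  assumes "0 < p" "p \<le> 1"
  shows "(\<Sum>k=1..N. real k powr (p - 1)) \<le> real N powr p / p"
proof (induction N)
  case (Suc N)
  have step: "p * real (Suc N) powr (p - 1) \<le> real (Suc N) powr p - real N powr p"
  proof (cases "N = 0")
    case False
    \<comment> \<open>The mean value theorem needs a derivative at the left end point, so the step from \<open>0\<close> is separate.\<close>
    have "\<exists>z>real N. z < real (Suc N) \<and>
      real (Suc N) powr p - real N powr p = (real (Suc N) - real N) * (p * z powr (p - 1))"
      by (rule MVT2) (use False in \<open>auto intro!: has_real_derivative_powr\<close>)
    then obtain z where z: "real N < z" "z < real (Suc N)"
      "real (Suc N) powr p - real N powr p = (real (Suc N) - real N) * (p * z powr (p - 1))"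
      by blast
    moreover have "real (Suc N) powr (p - 1) \<le> z powr (p - 1)"
      using z assms by (intro powr_mono2') auto
    ultimately show ?thesis using assms by simp
  qed (use assms in auto)
  have "(\<Sum>k=1..Suc N. real k powr (p - 1)) \<le> real N powr p / p + real (Suc N) powr (p - 1)"
    using Suc by simp
  also have "\<dots> \<le> real (Suc N) powr p / p"
  proof -
    have "real (Suc N) powr (p - 1) \<le> (real (Suc N) powr p - real N powr p) / p"
      using step assms by (simp add: pos_le_divide_eq mult.commute)
    then show ?thesis by (simp add: diff_divide_distrib)
  qed
  finally show ?case .
qed (use assms in auto)

lemma powr_inverse_le_iff:
  fixes x y p :: real
  assumes "0 \<le> x" "0 \<le> y" "0 < p"
  shows "x powr (1 / p) \<le> y \<longleftrightarrow> x \<le> y powr p"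
proof -
  have "x powr (1 / p) \<le> y \<longleftrightarrow> (x powr (1 / p)) powr p \<le> y powr p"
    using assms by (metis powr_ge_zero powr_less_mono2 powr_mono2 less_imp_le not_le)
  then show ?thesis using assms by (simp add: powr_powr)
qed

lemma le_powr_inverse_iff:
  fixes x y p :: real
  assumes "0 \<le> x" "0 \<le> y" "0 < p"
  shows "y \<le> x powr (1 / p) \<longleftrightarrow> y powr p \<le> x"
proof -
  have "y \<le> x powr (1 / p) \<longleftrightarrow> y powr p \<le> (x powr (1 / p)) powr p"
    using assms by (metis powr_ge_zero powr_less_mono2 powr_mono2 less_imp_le not_le)
  then show ?thesis using assms by (simp add: powr_powr)
qed

text \<open>
  The two terms of the maximum cross at \<open>\<delta> = R powr (- \<beta>)\<close>. As functions of \<open>\<delta>\<close> the first is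
  constant, the left side grows like \<open>\<delta> powr p\<close>, and the second is linear; since \<open>0 < p \<le> 1\<close>, only the
  crossing point has to be compared, and there the claim is \<open>\<beta> * (1 - p) \<le> p\<close>.
\<close>
lemma powr_interpolation:
  fixes \<delta> R p \<beta> s :: real
  assumes "0 < p" "p \<le> 1" "\<beta> * (1 - p) \<le> p" "1 \<le> R" "0 \<le> \<delta>"
  shows "\<delta> powr p * R powr (s - p) \<le> max (R powr (s - \<beta>)) (R powr s * \<delta>)"
proof (cases "R powr (- \<beta>) \<le> \<delta>")
  case True
  then have pos: "\<delta> > 0" using assms by (smt (verit) powr_gt_zero)
  \<comment> \<open>Here \<open>\<delta>\<close> is large, and the term is dominated by the volume term \<open>R powr s * \<delta>\<close>.\<close>
  have "\<delta> powr p = \<delta> * \<delta> powr (p - 1)" using pos by (simp add: powr_diff)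
  also have "\<dots> \<le> \<delta> * (R powr (- \<beta>)) powr (p - 1)"
    using assms True pos by (intro mult_left_mono powr_mono2') auto
  also have "(R powr (- \<beta>)) powr (p - 1) = R powr (\<beta> * (1 - p))"
    by (simp add: powr_powr algebra_simps)
  also have "\<delta> * \<dots> \<le> \<delta> * R powr p" using assms by (intro mult_left_mono powr_mono) auto
  finally have "\<delta> powr p * R powr (s - p) \<le> \<delta> * R powr p * R powr (s - p)"
    by (intro mult_right_mono) auto
  also have "\<dots> = R powr s * \<delta>" by (simp flip: powr_add)
  finally show ?thesis by simp
next
  case False
  \<comment> \<open>Here \<open>\<delta>\<close> is small, and the term is dominated by its value at \<open>\<delta> = R powr (- \<beta>)\<close>.\<close>
  then have "\<delta> powr p \<le> (R powr (- \<beta>)) powr p" using assms by (intro powr_mono2) auto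
  then have "\<delta> powr p * R powr (s - p) \<le> (R powr (- \<beta>)) powr p * R powr (s - p)"
    by (intro mult_right_mono) auto
  also have "\<dots> = R powr (- \<beta> * p + (s - p))" by (simp only: powr_powr powr_add)
  also have "\<dots> \<le> R powr (s - \<beta>)" using assms by (intro powr_mono) (auto simp: algebra_simps)
  finally show ?thesis by simp
qed

section \<open>Integer points in Euclidean shells\<close>

definition integer_lattice :: "(real ^ 'k) set" where
  "integer_lattice = {z. \<forall>i. z $ i \<in> \<int>}"

lemma dist_integer_lattice_ge_1:
  fixes z w :: "real ^ 'k::finite"
  assumes "z \<in> integer_lattice" "w \<in> integer_lattice" "z \<noteq> w"
  shows "1 \<le> dist z w"
proof -
  obtain i where i: "z $ i \<noteq> w $ i" using assms(3) by (auto simp: vec_eq_iff)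
  have "(z - w) $ i \<in> \<int>" "(z - w) $ i \<noteq> 0"
    using assms i by (auto simp: integer_lattice_def)
  then have "1 \<le> \<bar>(z - w) $ i\<bar>" using Ints_nonzero_abs_ge1 by blast
  also have "\<dots> \<le> norm (z - w)" by (rule component_le_norm_cart)
  finally show ?thesis by (simp add: dist_norm)
qed

text \<open>
  Balls of radius \<open>1/2\<close> about the lattice points are disjoint and lie in the shell widened by \<open>1/2\<close>
  on both sides, so comparing volumes bounds their number. The powers of the volume of the unit
  ball cancel, and the difference of \<open>k\<close>-th powers is estimated by \<open>power_diff_le\<close>.
\<close>
lemma card_lattice_shell:
  fixes a b :: real
  assumes "a \<le> b" "0 \<le> b"
  defines "S \<equiv> {z \<in> (integer_lattice :: (real ^ 'k::finite) set). a \<le> norm z \<and> norm z \<le> b}"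
  shows "finite S"
    and "real (card S) \<le> 2 ^ CARD('k) * real CARD('k) * (b - a + 1) * (b + 1/2) ^ (CARD('k) - 1)"
proof -
  let ?K = "CARD('k)"
  define B where "B = 2 ^ ?K * real ?K * (b - a + 1) * (b + 1/2) ^ (?K - 1)"
  define V where "V = unit_ball_vol (real ?K)"
  \<comment> \<open>The inner radius is cut off at \<open>0\<close>, so that one formula covers shells that reach the origin.\<close>
  define a' where "a' = max 0 (a - 1/2)"
  have V: "V > 0" by (simp add: V_def)
  have content: "measure lborel (ball c r) = V * r ^ ?K" if "0 \<le> r" for r and c :: "real ^ 'k"
    using content_ball[OF that, of c] by (simp add: V_def)
  have fmeasurable_ball: "ball c r \<in> fmeasurable lborel" if "0 \<le> r" for r and c :: "real ^ 'k"
    by (rule fmeasurableI) (simp_all add: emeasure_ball[OF that])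
  have bound: "real (card G) \<le> B" if G: "G \<subseteq> S" "finite G" for G
  proof -
    have "real (card G) * (V * (1/2) ^ ?K) = (\<Sum>z\<in>G. measure lborel (ball z (1/2)))"
      by (simp add: content)
    also have "\<dots> = measure lborel (\<Union>z\<in>G. ball z (1/2))"
    proof (rule measure_UNION'[symmetric])
      show "pairwise (\<lambda>z w. disjnt (ball z (1/2)) (ball w (1/2))) G"
      proof (intro pairwiseI)
        fix z w assume "z \<in> G" "w \<in> G" "z \<noteq> w"
        then have "1 \<le> dist z w" using G by (intro dist_integer_lattice_ge_1) (auto simp: S_def)
        then show "disjnt (ball z (1/2)) (ball w (1/2))"
          by (auto simp: disjnt_iff) (smt (verit) dist_commute dist_triangle field_sum_of_halves)
      qed
    qed (use G fmeasurable_ball in auto)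
    also have "\<dots> \<le> measure lborel (ball 0 (b + 1/2) - ball (0::real^'k) a')"
    proof (rule measure_mono_fmeasurable)
      show "(\<Union>z\<in>G. ball z (1/2)) \<subseteq> ball 0 (b + 1/2) - ball (0::real^'k) a'"
      proof
        fix x :: "real^'k" assume "x \<in> (\<Union>z\<in>G. ball z (1/2))"
        then obtain z where z: "z \<in> G" "dist z x < 1/2" by auto
        then have "a \<le> norm z" "norm z \<le> b" using G by (auto simp: S_def)
        moreover have "\<bar>norm z - norm x\<bar> < 1/2"
          using z norm_triangle_ineq3[of z x] by (simp add: dist_norm)
        ultimately have "norm x < b + 1/2" "a - 1/2 \<le> norm x" by linarith+
        then show "x \<in> ball 0 (b + 1/2) - ball 0 a'"
          using norm_ge_zero[of x] unfolding a'_def by (auto simp del: norm_ge_zero simp: max_def)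
      qed
      show "ball 0 (b + 1/2) - ball (0::real^'k) a' \<in> fmeasurable lborel"
        by (intro fmeasurable_Diff fmeasurable_ball) (use assms in auto)
    qed (auto intro!: borel_open)
    also have "\<dots> = measure lborel (ball (0::real^'k) (b + 1/2)) - measure lborel (ball (0::real^'k) a')"
      by (rule measurable_measure_Diff) (use assms in \<open>auto simp: a'_def intro!: subset_ball fmeasurable_ball\<close>)
    also have "\<dots> = V * ((b + 1/2) ^ ?K - a' ^ ?K)"
      using assms by (simp add: content a'_def algebra_simps)
    also have "\<dots> \<le> V * (real ?K * (b + 1/2 - a') * (b + 1/2) ^ (?K - 1))"
      using V assms by (intro mult_left_mono power_diff_le) (auto simp: a'_def)
    also have "\<dots> \<le> V * (real ?K * (b - a + 1) * (b + 1/2) ^ (?K - 1))"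
      using V assms by (intro mult_left_mono mult_right_mono) (auto simp: a'_def)
    finally have "V * (real (card G) * (1/2) ^ ?K) \<le> V * (real ?K * (b - a + 1) * (b + 1/2) ^ (?K - 1))"
      by (simp only: mult_ac)
    then have "real (card G) * (1/2) ^ ?K \<le> real ?K * (b - a + 1) * (b + 1/2) ^ (?K - 1)"
      using V by (simp only: mult_le_cancel_left_pos)
    then have "real (card G) \<le> 2 ^ ?K * (real ?K * (b - a + 1) * (b + 1/2) ^ (?K - 1))"
      by (simp add: power_one_over pos_divide_le_eq mult.commute)
    then show ?thesis by (simp only: B_def mult.assoc)
  qed
  \<comment> \<open>Finiteness of the shell is itself a consequence of the uniform bound for its finite subsets.\<close>
  have fin: "finite S \<and> card S \<le> nat \<lfloor>B\<rfloor>"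
  proof (rule finite_if_finite_subsets_card_bdd)
    fix G assume "G \<subseteq> S" "finite G"
    from bound[OF this] show "card G \<le> nat \<lfloor>B\<rfloor>" by (simp add: le_nat_floor)
  qed
  then show "finite S" by blast
  show "real (card S) \<le> 2 ^ ?K * real ?K * (b - a + 1) * (b + 1/2) ^ (?K - 1)"
    using bound[of S] fin by (simp add: B_def)
qed

text \<open>
  Group the lattice points by the integer part \<open>k\<close> of their distance \<open>\<rho> - |z|\<close> to the sphere. Each
  group lies in a unit shell and so has at most a constant times \<open>\<rho> ^ (CARD('k) - 1)\<close> points, and the
  remaining sum of \<open>k powr (p - 1)\<close> is of order \<open>\<rho> powr p\<close>. The singularity of the integrand at the
  sphere is integrable precisely because \<open>p > 0\<close>.
\<close>
lemma sum_lattice_distance_powr: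
  fixes p \<rho> :: real
  assumes "0 < p" "p \<le> 1" "1 \<le> \<rho>"
  defines "I \<equiv> {z \<in> (integer_lattice :: (real ^ 'k::finite) set). norm z \<le> \<rho> - 1}"
  shows "(\<Sum>z\<in>I. (\<rho> - norm z) powr (p - 1))
           \<le> 4 ^ CARD('k) * real CARD('k) / p * \<rho> powr (real CARD('k) - 1 + p)"
proof -
  let ?K = "CARD('k)"
  have K: "?K \<ge> 1" by (simp add: Suc_leI)
  define N where "N = nat \<lfloor>\<rho>\<rfloor>"
  define g where "g z = nat \<lfloor>\<rho> - norm z\<rfloor>" for z :: "real ^ 'k"
  have "I = {z \<in> integer_lattice. 0 \<le> norm z \<and> norm z \<le> \<rho> - 1}" by (auto simp: I_def)
  then have fin: "finite I" using card_lattice_shell(1)[of 0 "\<rho> - 1", where 'k='k] assms by simp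
  have g: "1 \<le> g z" "g z \<le> N" "real (g z) \<le> \<rho> - norm z" "\<rho> - norm z \<le> real (g z) + 1"
    if "z \<in> I" for z
  proof -
    have *: "1 \<le> \<rho> - norm z" "\<rho> - norm z \<le> \<rho>" using that by (auto simp: I_def)
    show "1 \<le> g z" using * by (simp add: g_def le_nat_floor)
    show "g z \<le> N" using * unfolding g_def N_def by (intro nat_mono floor_mono)
    have "real (g z) = of_int \<lfloor>\<rho> - norm z\<rfloor>" using * by (simp add: g_def)
    then show "real (g z) \<le> \<rho> - norm z" "\<rho> - norm z \<le> real (g z) + 1" by linarith+
  qed
  have card: "real (card {z \<in> I. g z = k}) \<le> 4 ^ ?K * real ?K * \<rho> ^ (?K - 1)"
    if k: "k \<in> {1..N}" for k
  proof -
    have kN: "real k \<le> \<rho>" "1 \<le> real k" using k assms by (auto simp: N_def le_nat_iff le_floor_iff)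
    have "card {z \<in> I. g z = k}
        \<le> card {z \<in> (integer_lattice :: (real ^ 'k) set). \<rho> - real k - 1 \<le> norm z \<and> norm z \<le> \<rho> - real k}"
      by (rule card_mono[OF card_lattice_shell(1)]) (use kN g in \<open>force simp: I_def\<close>)+
    then have "real (card {z \<in> I. g z = k})
        \<le> real (card {z \<in> (integer_lattice :: (real ^ 'k) set). \<rho> - real k - 1 \<le> norm z \<and> norm z \<le> \<rho> - real k})"
      by simp
    also have "\<dots> \<le> 2 ^ ?K * real ?K * (\<rho> - real k - (\<rho> - real k - 1) + 1) * (\<rho> - real k + 1/2) ^ (?K - 1)"
      by (rule card_lattice_shell(2)) (use kN in auto)
    also have "\<dots> \<le> 2 ^ ?K * real ?K * 2 * (2 * \<rho>) ^ (?K - 1)"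
      by (intro mult_mono power_mono) (use kN assms in auto)
    also have "\<dots> = (2 ^ ?K * (2 * 2 ^ (?K - 1))) * real ?K * \<rho> ^ (?K - 1)"
      by (simp add: power_mult_distrib)
    also have "(2::real) ^ ?K * (2 * 2 ^ (?K - 1)) = 4 ^ ?K"
      using K by (simp add: power_mult_distrib[symmetric] flip: power_Suc)
    finally show ?thesis .
  qed
  have "(\<Sum>z\<in>I. (\<rho> - norm z) powr (p - 1))
      = (\<Sum>k=1..N. \<Sum>z\<in>{z\<in>I. g z = k}. (\<rho> - norm z) powr (p - 1))"
    by (rule sum.group[symmetric]) (use fin g in auto)
  also have "\<dots> \<le> (\<Sum>k=1..N. \<Sum>z\<in>{z\<in>I. g z = k}. real k powr (p - 1))"
  proof (intro sum_mono)
    fix k z assume "k \<in> {1..N}" "z \<in> {z \<in> I. g z = k}"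
    then show "(\<rho> - norm z) powr (p - 1) \<le> real k powr (p - 1)"
      using assms g[of z] by (intro powr_mono2') auto
  qed
  also have "\<dots> = (\<Sum>k=1..N. real (card {z\<in>I. g z = k}) * real k powr (p - 1))"
    by simp
  also have "\<dots> \<le> (\<Sum>k=1..N. 4 ^ ?K * real ?K * \<rho> ^ (?K - 1) * real k powr (p - 1))"
    by (intro sum_mono mult_right_mono card) auto
  also have "\<dots> = 4 ^ ?K * real ?K * \<rho> ^ (?K - 1) * (\<Sum>k=1..N. real k powr (p - 1))"
    by (simp add: sum_distrib_left)
  also have "\<dots> \<le> 4 ^ ?K * real ?K * \<rho> ^ (?K - 1) * (\<rho> powr p / p)"
  proof (rule mult_left_mono)
    have "(\<Sum>k=1..N. real k powr (p - 1)) \<le> real N powr p / p"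
      by (rule sum_powr_le[OF assms(1,2)])
    also have "\<dots> \<le> \<rho> powr p / p"
      using assms by (intro divide_right_mono powr_mono2) (auto simp: N_def)
    finally show "(\<Sum>k=1..N. real k powr (p - 1)) \<le> \<rho> powr p / p" .
  qed (use assms in auto)
  also have "\<rho> ^ (?K - 1) = \<rho> powr (real ?K - 1)"
    using assms K by (simp add: powr_realpow[symmetric] of_nat_diff)
  finally show ?thesis
    by (simp add: powr_add mult_ac)
qed

section \<open>Slices in the last coordinate\<close>

lemma card_int_abs_interval:
  fixes u v :: real
  assumes "0 \<le> u" "u \<le> v"
  shows "finite {t::real. t \<in> \<int> \<and> u \<le> \<bar>t\<bar> \<and> \<bar>t\<bar> \<le> v}"
    and "real (card {t::real. t \<in> \<int> \<and> u \<le> \<bar>t\<bar> \<and> \<bar>t\<bar> \<le> v}) \<le> 2 * (v - u + 1)"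
proof -
  define P where "P = real_of_int ` {\<lceil>u\<rceil>..\<lfloor>v\<rfloor>}"
  have sub: "{t::real. t \<in> \<int> \<and> u \<le> \<bar>t\<bar> \<and> \<bar>t\<bar> \<le> v} \<subseteq> P \<union> uminus ` P"
  proof
    fix t :: real assume "t \<in> {t::real. t \<in> \<int> \<and> u \<le> \<bar>t\<bar> \<and> \<bar>t\<bar> \<le> v}"
    then obtain j where j: "t = real_of_int j" "u \<le> \<bar>t\<bar>" "\<bar>t\<bar> \<le> v" by (auto elim: Ints_cases)
    then have "\<bar>j\<bar> \<in> {\<lceil>u\<rceil>..\<lfloor>v\<rfloor>}" by (auto simp: ceiling_le_iff le_floor_iff)
    then have "\<bar>t\<bar> \<in> P" using j unfolding P_def by (metis imageI of_int_abs)
    then show "t \<in> P \<union> uminus ` P"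
      by (cases "0 \<le> t") (auto intro: rev_image_eqI)
  qed
  have fin: "finite (P \<union> uminus ` P)" by (simp add: P_def)
  then show "finite {t::real. t \<in> \<int> \<and> u \<le> \<bar>t\<bar> \<and> \<bar>t\<bar> \<le> v}" using sub finite_subset by blast
  have "card {t::real. t \<in> \<int> \<and> u \<le> \<bar>t\<bar> \<and> \<bar>t\<bar> \<le> v} \<le> card (P \<union> uminus ` P)"
    by (rule card_mono[OF fin sub])
  also have "\<dots> \<le> card P + card (uminus ` P)" by (rule card_Un_le)
  also have "\<dots> \<le> 2 * card P" using card_image_le[of P uminus] by (simp add: P_def)
  also have "card P = nat (\<lfloor>v\<rfloor> - \<lceil>u\<rceil> + 1)"
    unfolding P_def by (subst card_image) (auto simp: inj_on_def)
  finally have "real (card {t::real. t \<in> \<int> \<and> u \<le> \<bar>t\<bar> \<and> \<bar>t\<bar> \<le> v}) \<le> 2 * real (nat (\<lfloor>v\<rfloor> - \<lceil>u\<rceil> + 1))"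
    by (simp add: of_nat_mono flip: of_nat_mult)
  also have "real (nat (\<lfloor>v\<rfloor> - \<lceil>u\<rceil> + 1)) \<le> v - u + 1"
    using assms by linarith
  finally show "real (card {t::real. t \<in> \<int> \<and> u \<le> \<bar>t\<bar> \<and> \<bar>t\<bar> \<le> v}) \<le> 2 * (v - u + 1)" by simp
qed

text \<open>
  Taking \<open>p\<close>-th powers turns the condition into \<open>max 0 B powr p \<le> |t| \<le> A powr p\<close>; the lower
  bound \<open>B\<close> may be negative, in which case it is void.
\<close>
lemma card_int_powr_interval:
  fixes A B p :: real
  assumes "0 \<le> A" "B \<le> A" "0 < p"
  defines "T \<equiv> {t::real. t \<in> \<int> \<and> B \<le> \<bar>t\<bar> powr (1 / p) \<and> \<bar>t\<bar> powr (1 / p) \<le> A}"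
  shows "finite T" and "real (card T) \<le> 2 * (A powr p - max 0 B powr p + 1)"
proof -
  have "B \<le> \<bar>t\<bar> powr (1 / p) \<longleftrightarrow> max 0 B powr p \<le> \<bar>t\<bar>" for t
    using le_powr_inverse_iff[of "\<bar>t\<bar>" "max 0 B" p] assms by simp
  then have T: "T = {t::real. t \<in> \<int> \<and> max 0 B powr p \<le> \<bar>t\<bar> \<and> \<bar>t\<bar> \<le> A powr p}"
    using assms by (auto simp: powr_inverse_le_iff)
  have le: "max 0 B powr p \<le> A powr p" using assms by (intro powr_mono2) auto
  show "finite T" "real (card T) \<le> 2 * (A powr p - max 0 B powr p + 1)"
    unfolding T using card_int_abs_interval[OF _ le] by auto
qed

text \<open>
  Both bounds on the gauge become bounds on \<open>|t| powr (\<alpha> / 2)\<close> for fixed \<open>z\<close>; this is the form in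
  which the shell is cut into slices.
\<close>
lemma alpha_norm_between_iff:
  assumes "\<alpha> \<ge> 1" "0 \<le> \<rho>" "0 \<le> \<rho>'"
  shows "\<rho> \<le> alpha_norm \<alpha> (z, t) \<and> alpha_norm \<alpha> (z, t) \<le> \<rho>' \<longleftrightarrow>
    \<rho> ^ \<alpha> - norm z ^ \<alpha> \<le> \<bar>t\<bar> powr (real \<alpha> / 2) \<and> \<bar>t\<bar> powr (real \<alpha> / 2) \<le> \<rho>' ^ \<alpha> - norm z ^ \<alpha>"
proof -
  have "0 \<le> norm z ^ \<alpha> + \<bar>t\<bar> powr (real \<alpha> / 2)" by simp
  then show ?thesis
    using assms unfolding alpha_norm_def
    by (auto simp: le_powr_inverse_iff powr_inverse_le_iff powr_realpow')
qed

section \<open>Counting in shells of the anisotropic gauge\<close>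

text \<open>
  The bound behind the three cases, with \<open>p = 2 / \<alpha>\<close>. The volume term is \<open>R ^ n * \<delta>\<close>. The term
  \<open>R ^ (n - 1)\<close> pays for rounding in each slice, one for every lattice point \<open>z\<close>. The middle term comes
  from the points \<open>z\<close> within bounded distance of the equator: there are of order \<open>R ^ (n - 2)\<close> of
  them, and each carries, beyond rounding, at most a constant times
  \<open>(R powr (\<alpha> - 1) * \<delta>) powr p = \<delta> powr p * R powr (2 - p)\<close> values of \<open>t\<close>.
\<close>
theorem card_lattice_alpha_shell:
  fixes \<alpha> :: nat
  assumes \<alpha>: "\<alpha> \<ge> 2"
  defines "p \<equiv> 2 / real \<alpha>"
  shows "\<exists>C>0. \<forall>(\<delta>::real) (R::real). 0 \<le> \<delta> \<and> \<delta> < 1 \<and> R > 1 \<longrightarrow>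
    (let S = {m \<in> (integer_points :: ((real ^ 'k::finite) \<times> real) set).
                R - \<delta> \<le> alpha_norm \<alpha> m \<and> alpha_norm \<alpha> m \<le> R + \<delta>};
         n = CARD('k) + 1
     in finite S \<and>
        real (card S) \<le> C * (R ^ (n - 1) + \<delta> powr p * R powr (real n - p) + R ^ n * \<delta>))"
proof -
  let ?K = "CARD('k)"
  have K: "?K \<ge> 1" by (simp add: Suc_leI)
  have p: "0 < p" "p \<le> 1" and p\<alpha>: "real \<alpha> * p = 2" using \<alpha> by (auto simp: p_def)
  have \<alpha>1: "real (\<alpha> - 1) = real \<alpha> - 1" using \<alpha> by (simp add: of_nat_diff)
  \<comment> \<open>With \<open>c\<close> bounding the growth of \<open>r ^ \<alpha>\<close> across the shell, the three summands of \<open>C\<close> count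
    the spare point of each slice, the slices near the equator and the slices away from it.\<close>
  define c where "c = real \<alpha> * 2 * 2 ^ (\<alpha> - 1)"
  define C1 where "C1 = 2 ^ ?K * real ?K * 3 ^ ?K"
  define C2 where "C2 = 2 ^ ?K * real ?K * 4 * 3 ^ (?K - 1)"
  define C3 where "C3 = 4 ^ ?K * real ?K / p"
  define C where "C = 2 * C1 + 2 * C2 * c powr p + 2 * c * 2 ^ \<alpha> * C3"
  have c: "c > 0" using \<alpha> by (simp add: c_def)
  have pos: "C1 > 0" "C2 > 0" "C3 > 0" using K p by (auto simp: C1_def C2_def C3_def)
  have "C > 0" using pos c by (auto simp: C_def intro!: add_pos_pos)
  moreover have "finite S \<and> real (card S) \<le> C * (R ^ ?K + \<delta> powr p * R powr (real ?K + 1 - p) + R ^ (?K + 1) * \<delta>)"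
    if \<delta>: "0 \<le> \<delta>" "\<delta> < 1" and R: "R > 1"
      and S: "S = {m \<in> (integer_points :: ((real ^ 'k) \<times> real) set).
                R - \<delta> \<le> alpha_norm \<alpha> m \<and> alpha_norm \<alpha> m \<le> R + \<delta>}" for \<delta> R S
  proof -
    define \<rho> where "\<rho> = R - \<delta>"
    define \<rho>' where "\<rho>' = R + \<delta>"
    have \<rho>: "0 < \<rho>" "\<rho> \<le> \<rho>'" "\<rho> \<le> R" "\<rho>' \<le> 2 * R" using \<delta> R by (auto simp: \<rho>_def \<rho>'_def)
    define A where "A z = \<rho>' ^ \<alpha> - norm z ^ \<alpha>" for z :: "real ^ 'k"
    define B where "B z = \<rho> ^ \<alpha> - norm z ^ \<alpha>" for z :: "real ^ 'k"
    define D where "D = \<rho>' ^ \<alpha> - \<rho> ^ \<alpha>"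
    define T where "T z = {t::real. t \<in> \<int> \<and> B z \<le> \<bar>t\<bar> powr (1 / p) \<and> \<bar>t\<bar> powr (1 / p) \<le> A z}" for z
    \<comment> \<open>The vacuous lower bound puts the ball into the form of a shell.\<close>
    define Ball where "Ball = {z \<in> (integer_lattice :: (real ^ 'k) set). 0 \<le> norm z \<and> norm z \<le> \<rho>'}"
    define Inner where "Inner = {z \<in> (integer_lattice :: (real ^ 'k) set). norm z \<le> \<rho> - 1}"
    define Outer where "Outer = {z \<in> (integer_lattice :: (real ^ 'k) set). \<rho> - 1 \<le> norm z \<and> norm z \<le> \<rho>'}"
    have p_inv: "1 / p = real \<alpha> / 2" by (simp add: p_def)
    have AB: "A z - B z = D" for z by (simp add: A_def B_def D_def)
    have D0: "D \<ge> 0" using \<rho> by (simp add: D_def power_mono)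
    have A0: "A z \<ge> 0" if "z \<in> Ball" for z using that by (auto simp: A_def Ball_def power_mono)

    have fin_Ball: "finite Ball" unfolding Ball_def by (rule card_lattice_shell) (use \<rho> in auto)
    have card_Ball: "real (card Ball) \<le> C1 * R ^ ?K"
    proof -
      have "real (card Ball) \<le> 2 ^ ?K * real ?K * (\<rho>' - 0 + 1) * (\<rho>' + 1/2) ^ (?K - 1)"
        unfolding Ball_def by (rule card_lattice_shell) (use \<rho> in auto)
      also have "\<dots> \<le> 2 ^ ?K * real ?K * (3 * R) * (3 * R) ^ (?K - 1)"
        by (intro mult_mono power_mono) (use \<rho> \<delta> R in \<open>auto simp: \<rho>'_def\<close>)
      also have "\<dots> = 2 ^ ?K * real ?K * (3 * R) ^ ?K"
        using K by (metis mult.assoc power_eq_if not_one_le_zero)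
      finally show ?thesis by (simp add: C1_def power_mult_distrib)
    qed
    have fin_Outer: "finite Outer" unfolding Outer_def by (rule card_lattice_shell) (use \<rho> in auto)
    have card_Outer: "real (card Outer) \<le> C2 * R ^ (?K - 1)"
    proof -
      have "real (card Outer) \<le> 2 ^ ?K * real ?K * (\<rho>' - (\<rho> - 1) + 1) * (\<rho>' + 1/2) ^ (?K - 1)"
        unfolding Outer_def by (rule card_lattice_shell) (use \<rho> in auto)
      also have "\<dots> \<le> 2 ^ ?K * real ?K * 4 * (3 * R) ^ (?K - 1)"
        by (intro mult_mono power_mono) (use \<rho> \<delta> R in \<open>auto simp: \<rho>_def \<rho>'_def\<close>)
      finally show ?thesis by (simp add: C2_def power_mult_distrib)
    qed
    have Inner_Ball: "Inner \<subseteq> Ball" and Diff_Outer: "Ball - Inner \<subseteq> Outer"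
      using \<rho> by (auto simp: Inner_def Ball_def Outer_def)

    have D_le: "D \<le> c * \<delta> * R powr (real \<alpha> - 1)"
    proof -
      have "D \<le> real \<alpha> * (\<rho>' - \<rho>) * \<rho>' ^ (\<alpha> - 1)"
        unfolding D_def using \<rho> by (intro power_diff_le) auto
      also have "\<dots> \<le> real \<alpha> * (2 * \<delta>) * (2 * R) ^ (\<alpha> - 1)"
        by (intro mult_mono power_mono) (use \<rho> \<delta> in \<open>auto simp: \<rho>_def \<rho>'_def\<close>)
      also have "\<dots> = c * \<delta> * R ^ (\<alpha> - 1)"
        by (simp add: c_def power_mult_distrib)
      also have "R ^ (\<alpha> - 1) = R powr (real \<alpha> - 1)" using R \<alpha>1 by (simp flip: powr_realpow)
      finally show ?thesis .
    qed
    have Dp: "D powr p \<le> c powr p * \<delta> powr p * R powr (2 - p)"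
    proof -
      have "D powr p \<le> (c * \<delta> * R powr (real \<alpha> - 1)) powr p"
        using D_le D0 p by (intro powr_mono2) auto
      also have "\<dots> = c powr p * \<delta> powr p * R powr ((real \<alpha> - 1) * p)"
        using c \<delta> by (simp add: powr_mult powr_powr)
      also have "(real \<alpha> - 1) * p = 2 - p" using p\<alpha> by (simp add: algebra_simps)
      finally show ?thesis .
    qed

    have slice: "finite (T z)" "real (card (T z)) \<le> 2 * (A z powr p - max 0 (B z) powr p) + 2" if "z \<in> Ball" for z
      using card_int_powr_interval[OF A0[OF that], of "B z" p] AB[of z] D0 p unfolding T_def by auto
    \<comment> \<open>Near the equator \<open>|z| = \<rho>\<close> the derivative of \<open>x powr p\<close> may blow up, so subadditivity is used.\<close>
    have slice_outer: "real (card (T z)) \<le> 2 * D powr p + 2" if z: "z \<in> Ball" for z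
    proof -
      have "A z powr p - max 0 (B z) powr p \<le> (A z - max 0 (B z)) powr p"
        using A0[OF z] AB[of z] D0 p by (intro powr_diff_le_diff_powr) auto
      also have "\<dots> \<le> D powr p"
        using A0[OF z] AB[of z] D0 p by (intro powr_mono2) auto
      finally show ?thesis using slice(2)[OF z] by simp
    qed
    \<comment> \<open>Away from the equator \<open>B z\<close> is at least \<open>(\<rho> - |z|) * \<rho> ^ (\<alpha> - 1)\<close>, and the tangent bound applies.\<close>
    have slice_inner: "real (card (T z))
        \<le> 2 * (D * (\<rho> ^ (\<alpha> - 1)) powr (p - 1) * (\<rho> - norm z) powr (p - 1)) + 2" if z: "z \<in> Inner" for z
    proof -
      have z': "norm z \<le> \<rho> - 1" using z by (simp add: Inner_def)
      have B_ge: "(\<rho> - norm z) * \<rho> ^ (\<alpha> - 1) \<le> B z"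
        unfolding B_def using z' \<alpha> by (intro power_diff_ge) auto
      have pos': "0 < (\<rho> - norm z) * \<rho> ^ (\<alpha> - 1)" using z' \<rho> by simp
      have B0: "0 < B z" using B_ge pos' by linarith
      have "A z powr p - B z powr p \<le> (A z - B z) * B z powr (p - 1)"
        using B0 AB[of z] D0 p by (intro powr_diff_le_tangent) auto
      also have "\<dots> \<le> D * ((\<rho> - norm z) * \<rho> ^ (\<alpha> - 1)) powr (p - 1)"
        unfolding AB using p D0 B_ge pos' by (intro mult_left_mono powr_mono2') auto
      also have "\<dots> = D * (\<rho> ^ (\<alpha> - 1)) powr (p - 1) * (\<rho> - norm z) powr (p - 1)"
        using z' \<rho> by (simp add: powr_mult)
      finally show ?thesis using slice(2)[of z] z Inner_Ball B0 by auto
    qed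

    have inner: "(\<Sum>z\<in>Inner. D * (\<rho> ^ (\<alpha> - 1)) powr (p - 1) * (\<rho> - norm z) powr (p - 1))
        \<le> c * 2 ^ \<alpha> * C3 * (R ^ (?K + 1) * \<delta>)"
    proof (cases "\<rho> \<ge> 1")
      case True
      have e: "(\<rho> ^ (\<alpha> - 1)) powr (p - 1) \<le> 2 ^ \<alpha> * R powr ((real \<alpha> - 1) * (p - 1))"
      proof -
        \<comment> \<open>The exponent of \<open>\<rho>\<close> is nonpositive, so passing from \<open>\<rho>\<close> to \<open>R\<close> needs \<open>\<rho>\<close> to be at least a multiple of \<open>R\<close>.\<close>
        have "R / 2 \<le> \<rho>" using True \<delta> by (simp add: \<rho>_def)
        have "(\<rho> ^ (\<alpha> - 1)) powr (p - 1) = \<rho> powr ((real \<alpha> - 1) * (p - 1))"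
          using \<rho> \<alpha>1 by (simp add: powr_powr flip: powr_realpow)
        also have "\<dots> \<le> (R / 2) powr ((real \<alpha> - 1) * (p - 1))"
          using \<open>R / 2 \<le> \<rho>\<close> R \<alpha> p by (intro powr_mono2') (auto simp: mult_nonneg_nonpos)
        also have "\<dots> = 2 powr ((real \<alpha> - 1) * (1 - p)) * R powr ((real \<alpha> - 1) * (p - 1))"
        proof -
          have "(R / 2) powr q = 2 powr (- q) * R powr q" for q
            using R by (simp add: powr_divide powr_minus_divide)
          moreover have "(real \<alpha> - 1) * (1 - p) = - ((real \<alpha> - 1) * (p - 1))"
            by (simp add: algebra_simps)
          ultimately show ?thesis by (simp only:)
        qed
        also have "\<dots> \<le> 2 powr real \<alpha> * R powr ((real \<alpha> - 1) * (p - 1))"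
          using \<alpha> p p\<alpha> by (intro mult_right_mono powr_mono) (auto simp: algebra_simps)
        finally show ?thesis by (simp add: powr_realpow)
      qed
      have "(\<Sum>z\<in>Inner. D * (\<rho> ^ (\<alpha> - 1)) powr (p - 1) * (\<rho> - norm z) powr (p - 1))
          = D * (\<rho> ^ (\<alpha> - 1)) powr (p - 1) * (\<Sum>z\<in>Inner. (\<rho> - norm z) powr (p - 1))"
        by (simp add: sum_distrib_left)
      also have "\<dots> \<le> D * (\<rho> ^ (\<alpha> - 1)) powr (p - 1) * (C3 * \<rho> powr (real ?K - 1 + p))"
        using sum_lattice_distance_powr[OF p True, where 'k='k] D0
        by (intro mult_left_mono) (auto simp: Inner_def C3_def)
      also have "\<dots> \<le> (c * \<delta> * R powr (real \<alpha> - 1)) * (2 ^ \<alpha> * R powr ((real \<alpha> - 1) * (p - 1)))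
          * (C3 * R powr (real ?K - 1 + p))"
        using D_le D0 e pos \<rho> K p c \<delta> by (intro mult_mono powr_mono2) auto
      also have "\<dots> = c * 2 ^ \<alpha> * C3 * \<delta>
          * (R powr (real \<alpha> - 1) * R powr ((real \<alpha> - 1) * (p - 1)) * R powr (real ?K - 1 + p))"
        by (simp only: mult_ac)
      also have "R powr (real \<alpha> - 1) * R powr ((real \<alpha> - 1) * (p - 1)) * R powr (real ?K - 1 + p)
          = R powr (real ?K + 1)"
        using p\<alpha> by (simp add: algebra_simps flip: powr_add)
      also have "\<dots> = R ^ (?K + 1)" using R powr_realpow[of R "?K + 1"] by (simp add: add.commute)
      finally show ?thesis by (simp only: mult_ac)
    next
      case False
      have "Inner = {}"
      proof -
        have "\<not> norm z \<le> \<rho> - 1" for z :: "real ^ 'k" using False norm_ge_zero[of z] by linarith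
        then show ?thesis by (simp add: Inner_def)
      qed
      then show ?thesis using pos c \<delta> R by simp
    qed

    have S_eq: "S = Sigma Ball T"
    proof -
      have "(z, t) \<in> S \<longleftrightarrow> (z, t) \<in> Sigma Ball T" for z t
      proof -
        have "norm z \<le> \<rho>'" if "\<bar>t\<bar> powr (1 / p) \<le> A z"
        proof -
          have "0 \<le> A z" using that powr_ge_zero[of "\<bar>t\<bar>" "1 / p"] by linarith
          then show ?thesis using \<alpha> \<rho> by (simp add: A_def)
        qed
        then show ?thesis
          using alpha_norm_between_iff[of \<alpha> \<rho> \<rho>' z t] \<alpha> \<rho>
          by (auto simp: S integer_points_def integer_lattice_def Ball_def T_def A_def B_def p_inv
              simp flip: \<rho>_def \<rho>'_def)
      qed
      then show ?thesis by auto
    qed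
    have "finite S" unfolding S_eq using fin_Ball slice(1) by (rule finite_SigmaI)
    have "real (card S) = (\<Sum>z\<in>Ball. real (card (T z)))"
      unfolding S_eq using fin_Ball slice(1) by (simp add: card_SigmaI)
    also have "\<dots> = (\<Sum>z\<in>Ball - Inner. real (card (T z))) + (\<Sum>z\<in>Inner. real (card (T z)))"
      by (rule sum.subset_diff[OF Inner_Ball fin_Ball])
    also have "\<dots> \<le> (\<Sum>z\<in>Ball - Inner. 2 * D powr p + 2)
        + (\<Sum>z\<in>Inner. 2 * (D * (\<rho> ^ (\<alpha> - 1)) powr (p - 1) * (\<rho> - norm z) powr (p - 1)) + 2)"
      by (intro add_mono sum_mono slice_outer slice_inner) auto
    also have "\<dots> = (\<Sum>z\<in>Ball. 2) + 2 * (real (card (Ball - Inner)) * D powr p)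
        + 2 * (\<Sum>z\<in>Inner. D * (\<rho> ^ (\<alpha> - 1)) powr (p - 1) * (\<rho> - norm z) powr (p - 1))"
      unfolding sum.subset_diff[OF Inner_Ball fin_Ball, of "\<lambda>_. 2::real"]
      by (simp add: sum.distrib sum_distrib_left algebra_simps)
    also have "\<dots> \<le> 2 * (C1 * R ^ ?K)
        + 2 * ((C2 * R ^ (?K - 1)) * (c powr p * \<delta> powr p * R powr (2 - p)))
        + 2 * (c * 2 ^ \<alpha> * C3 * (R ^ (?K + 1) * \<delta>))"
    proof (intro add_mono mult_left_mono mult_mono Dp inner)
      show "(\<Sum>z\<in>Ball. 2) \<le> 2 * (C1 * R ^ ?K)" using card_Ball by simp
      have "card (Ball - Inner) \<le> card Outer" by (rule card_mono[OF fin_Outer Diff_Outer])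
      then show "real (card (Ball - Inner)) \<le> C2 * R ^ (?K - 1)" using card_Outer by simp
    qed (use pos R in auto)
    also have "(C2 * R ^ (?K - 1)) * (c powr p * \<delta> powr p * R powr (2 - p))
        = C2 * c powr p * (\<delta> powr p * R powr (real ?K + 1 - p))"
    proof -
      have "R ^ (?K - 1) * R powr (2 - p) = R powr (real ?K + 1 - p)"
        using R K by (simp add: of_nat_diff algebra_simps flip: powr_add powr_realpow)
      then show ?thesis by (metis mult.assoc mult.left_commute)
    qed
    also have "2 * (C1 * R ^ ?K) + 2 * (C2 * c powr p * (\<delta> powr p * R powr (real ?K + 1 - p)))
        + 2 * (c * 2 ^ \<alpha> * C3 * (R ^ (?K + 1) * \<delta>))
      \<le> C * R ^ ?K + C * (\<delta> powr p * R powr (real ?K + 1 - p)) + C * (R ^ (?K + 1) * \<delta>)"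
    proof -
      have "0 \<le> C1" "0 \<le> C2 * c powr p" "0 \<le> c * 2 ^ \<alpha> * C3" using pos c by auto
      then have "2 * C1 \<le> C" "2 * (C2 * c powr p) \<le> C" "2 * (c * 2 ^ \<alpha> * C3) \<le> C"
        unfolding C_def by (auto simp: algebra_simps)
      then show ?thesis
        unfolding mult.assoc[of 2, symmetric] using R \<delta> by (intro add_mono mult_right_mono) auto
    qed
    finally show ?thesis using \<open>finite S\<close> by (simp add: algebra_simps)
  qed
  ultimately show ?thesis
    by (intro exI[of _ C]) (simp add: Let_def add.commute)
qed

theorem theorem1p1:
  fixes d \<alpha> n :: nat
  assumes "d \<ge> 1" and "\<alpha> \<ge> 2" and "n = 2 * d + 1"
    and "CARD('k::finite) = 2 * d"
  shows "\<exists>C>0. \<forall>(\<delta>::real) (R::real). 0 \<le> \<delta> \<and> \<delta> < 1 \<and> R > 1 \<longrightarrow>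
    (let S = {m \<in> (integer_points :: ((real ^ 'k) \<times> real) set).
                R - \<delta> \<le> alpha_norm \<alpha> m \<and> alpha_norm \<alpha> m \<le> R + \<delta>}
     in finite S \<and>
        real (card S) \<le> C *
          (if \<alpha> \<ge> 2 * (n - 1) then max (R powr (real n - 1 / (real \<alpha> - 1))) (R ^ n * \<delta>)
           else if 2 < \<alpha> then max (R powr (real n - 1 / (2 * real n - 3))) (R ^ n * \<delta>)
           else max (R powr (real n - (real n - 2) / real n)) (R ^ n * \<delta>)))"
proof -
  define p where "p = 2 / real \<alpha>"
  define \<beta> where "\<beta> = (if \<alpha> \<ge> 2 * (n - 1) then 1 / (real \<alpha> - 1)
    else if 2 < \<alpha> then 1 / (2 * real n - 3) else (real n - 2) / real n)"
  have n: "n \<ge> 3" "CARD('k) + 1 = n" using assms by auto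
  have p: "0 < p" "p \<le> 1" using assms by (auto simp: p_def)
  \<comment> \<open>All that matters about the exponent: \<open>\<beta> \<le> 1\<close> absorbs \<open>R ^ (n - 1)\<close>, and the second inequality,
    which is \<open>\<beta> * (1 - p) \<le> p\<close> after clearing denominators, absorbs the equatorial term.\<close>
  have \<beta>: "\<beta> \<le> 1" "\<beta> * (real \<alpha> - 2) \<le> 2"
  proof -
    consider "\<alpha> \<ge> 2 * (n - 1)" | "\<not> \<alpha> \<ge> 2 * (n - 1)" "2 < \<alpha>" | "\<not> \<alpha> \<ge> 2 * (n - 1)" "\<alpha> = 2"
      using assms by linarith
    then have "\<beta> \<le> 1 \<and> \<beta> * (real \<alpha> - 2) \<le> 2"
    proof cases
      case 1
      then show ?thesis using n by (simp add: \<beta>_def field_simps)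
    next
      case 2
      then have "real \<alpha> \<le> 2 * real n - 2" by linarith
      then show ?thesis using 2 n by (simp add: \<beta>_def field_simps)
    next
      case 3
      then show ?thesis using n by (simp add: \<beta>_def)
    qed
    then show "\<beta> \<le> 1" "\<beta> * (real \<alpha> - 2) \<le> 2" by auto
  qed
  have \<beta>p: "\<beta> * (1 - p) \<le> p" 
  proof -
    have "real \<alpha> * p = 2" using assms by (simp add: p_def)
    then have "real \<alpha> * (\<beta> * (1 - p)) = \<beta> * (real \<alpha> - 2)"
      by (simp only: algebra_simps)
    then have "real \<alpha> * (\<beta> * (1 - p)) \<le> real \<alpha> * p"
      using \<beta>(2) \<open>real \<alpha> * p = 2\<close> by (simp only:)
    then show ?thesis using assms(2) by simp
  qed
  obtain C where C: "C > 0" and bound: "\<And>\<delta> R S. 0 \<le> \<delta> \<Longrightarrow> \<delta> < 1 \<Longrightarrow> R > 1 \<Longrightarrow>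
      S = {m \<in> (integer_points :: ((real ^ 'k) \<times> real) set).
             R - \<delta> \<le> alpha_norm \<alpha> m \<and> alpha_norm \<alpha> m \<le> R + \<delta>} \<Longrightarrow>
      finite S \<and> real (card S) \<le> C * (R ^ (n - 1) + \<delta> powr p * R powr (real n - p) + R ^ n * \<delta>)"
    using card_lattice_alpha_shell[OF assms(2), where 'k='k] unfolding Let_def n(2) p_def[symmetric] by blast
  have "finite S \<and> real (card S) \<le> 3 * C * max (R powr (real n - \<beta>)) (R ^ n * \<delta>)"
    if \<delta>: "0 \<le> \<delta>" "\<delta> < 1" and R: "R > 1"
      and S: "S = {m \<in> (integer_points :: ((real ^ 'k) \<times> real) set).
             R - \<delta> \<le> alpha_norm \<alpha> m \<and> alpha_norm \<alpha> m \<le> R + \<delta>}" for \<delta> R S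
  proof -
    define M where "M = max (R powr (real n - \<beta>)) (R ^ n * \<delta>)"
    have "R ^ (n - 1) = R powr (real n - 1)" using R n by (simp add: of_nat_diff flip: powr_realpow)
    also have "\<dots> \<le> R powr (real n - \<beta>)" using R \<beta> by (intro powr_mono) auto
    finally have 1: "R ^ (n - 1) \<le> M" by (simp add: M_def)
    have 2: "\<delta> powr p * R powr (real n - p) \<le> M"
      using powr_interpolation[OF p \<beta>p, of R \<delta> "real n"] R \<delta> by (simp add: M_def powr_realpow)
    have 3: "R ^ n * \<delta> \<le> M" by (simp add: M_def)
    have "C * (R ^ (n - 1) + \<delta> powr p * R powr (real n - p) + R ^ n * \<delta>) \<le> C * (M + M + M)"
      using 1 2 3 C by (intro mult_left_mono add_mono) auto
    then show ?thesis using bound[OF \<delta> R S] by (simp add: M_def)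
  qed
  moreover have "(if \<alpha> \<ge> 2 * (n - 1) then max (R powr (real n - 1 / (real \<alpha> - 1))) (R ^ n * \<delta>)
           else if 2 < \<alpha> then max (R powr (real n - 1 / (2 * real n - 3))) (R ^ n * \<delta>)
           else max (R powr (real n - (real n - 2) / real n)) (R ^ n * \<delta>))
      = max (R powr (real n - \<beta>)) (R ^ n * \<delta>)" for R \<delta> :: real
    by (simp add: \<beta>_def)
  ultimately show ?thesis
    using C by (intro exI[of _ "3 * C"]) (simp add: Let_def)
qed

end
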